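(* Let $X$ be a real linear space, $(Y,N)$ a fuzzy Banach space and $(Z,N')$ a fuzzy normed space. Let $\varphi_2: X\times X\to Z$ be a function such that for some real $\alpha>4$, $$N'\left(\varphi_2\left(\tfrac{x}{2\cdot 3},\tfrac{y}{2}\right),a\right)\ \ge\ N'\left(\varphi_2\left(\tfrac{x}{3},y\right),\alpha a\right)$$ for all $x\in X$, all $y\in\{0,\tfrac{x}{3},\tfrac{4x}{3},\tfrac{-2x}{3},x\}$ and all $a>0$, and such that $$\lim_{n\to\infty}N'\left(4^n\varphi_2(2^{-n}x,2^{-n}y),a\right)=1$$ for all $x,y\in X$ and all $a>0$. Let $f:X\to Y$ be an even function with $f(0)=0$ satisfying $$N\big(f(2x+y)+f(2x-y)-f(x+y)-f(x-y)-2f(2x)+2f(x),\,a\big)\ \ge\ N'(\varphi_2(x,y),a)$$ for all $a>0$ and all $x,y\in X$. Then there exists a unique quadratic mapping $Q:X\to Y$ such that $$N(Q(x)-f(x),a)\ \ge\ N''_2\left(x,\tfrac{a(\alpha-4)}{6}\right)$$ for all $x\in X$ and all $a>0$, where $$N''_2(x,a):=\min\Big\{N'\big(\varphi_2(\tfrac{x}{3},\tfrac{x}{3}),a\big),\,N'\big(\varphi_2(\tfrac{x}{3},x),a\big),\,N'\big(\varphi_2(\tfrac{x}{3},\tfrac{4x}{3}),a\big),\,N'\big(\varphi_2(\tfrac{x}{3},\tfrac{-2x}{3}),a\big),\,N'\big(\varphi_2(\tfrac{x}{3},0),a\big)\Big\}.$$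
   Context: Let $V$ be a real linear space. A function $N:V\times\mathbb{R}\to[0,1]$ is a fuzzy norm on $V$ if for all $x,y\in V$ and $a,b\in\mathbb{R}$: (N1) $N(x,a)=0$ for $a\le 0$; (N2) $x=0$ if and only if $N(x,a)=1$ for all $a>0$; (N3) $N(ax,b)=N(x,\frac{b}{|a|})$ if $a\ne 0$; (N4) $N(x+y,a+b)\ge\min\{N(x,a),N(y,b)\}$; (N5) $N(x,\cdot)$ is a non-decreasing function on $\mathbb{R}$ and $\lim_{a\to\infty}N(x,a)=1$; (N6) for $x\ne 0$, $N(x,\cdot)$ is upper semicontinuous on $\mathbb{R}$. The pair $(V,N)$ is then called a fuzzy normed (linear) space. A sequence $(x_n)$ in $V$ is convergent if there exists $x\in V$ with $\lim_{n\to\infty}N(x_n-x,a)=1$ for all $a>0$. It is Cauchy if for each $\epsilon>0$ and each $a>0$ there exists $n_0$ such that $N(x_{n+p}-x_n,a)>1-\epsilon$ for all $n\ge n_0$ and all $p>0$ (integers). A fuzzy Banach space is a fuzzy normed space in which every Cauchy sequence is convergent. A mapping $Q:X\to Y$ between real linear spaces is quadratic if $Q(x+y)+Q(x-y)=2Q(x)+2Q(y)$ for all $x,y\in X$. A function $f$ is even if $f(-x)=f(x)$ for all $x$. *)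

theory Defs
  imports "HOL-Analysis.Analysis"
begin

definition upper_semicontinuous :: "('a::topological_space \<Rightarrow> real) \<Rightarrow> bool" where
  "upper_semicontinuous g \<longleftrightarrow> (\<forall>t c. g t < c \<longrightarrow> (\<forall>\<^sub>F s in nhds t. g s < c))"

locale fuzzy_normed_space =
  fixes N :: "'v::real_vector \<Rightarrow> real \<Rightarrow> real"
  assumes range: "N x a \<in> {0..1}"
    and N1: "a \<le> 0 \<Longrightarrow> N x a = 0"
    and N2: "x = 0 \<longleftrightarrow> (\<forall>a>0. N x a = 1)"
    and N3: "a \<noteq> 0 \<Longrightarrow> N (a *\<^sub>R x) b = N x (b / \<bar>a\<bar>)"
    and N4: "N (x + y) (a + b) \<ge> min (N x a) (N y b)"
    and N5_mono: "mono (N x)"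
    and N5_lim: "(N x \<longlongrightarrow> 1) at_top"
    and N6: "x \<noteq> 0 \<Longrightarrow> upper_semicontinuous (N x)"

definition fuzzy_convergent :: "('v::real_vector \<Rightarrow> real \<Rightarrow> real) \<Rightarrow> (nat \<Rightarrow> 'v) \<Rightarrow> bool" where
  "fuzzy_convergent N s \<longleftrightarrow> (\<exists>x. \<forall>a>0. (\<lambda>n. N (s n - x) a) \<longlonglongrightarrow> 1)"

definition fuzzy_Cauchy :: "('v::real_vector \<Rightarrow> real \<Rightarrow> real) \<Rightarrow> (nat \<Rightarrow> 'v) \<Rightarrow> bool" where
  "fuzzy_Cauchy N s \<longleftrightarrow>
     (\<forall>\<epsilon>>0. \<forall>a>0. \<exists>n0. \<forall>n\<ge>n0. \<forall>p>0. N (s (n + p) - s n) a > 1 - \<epsilon>)"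

locale fuzzy_Banach_space = fuzzy_normed_space N
  for N :: "'v::real_vector \<Rightarrow> real \<Rightarrow> real" +
  assumes complete: "fuzzy_Cauchy N s \<Longrightarrow> fuzzy_convergent N s"

definition quadratic_mapping :: "('x::real_vector \<Rightarrow> 'y::real_vector) \<Rightarrow> bool" where
  "quadratic_mapping Q \<longleftrightarrow>
     (\<forall>x y. Q (x + y) + Q (x - y) = 2 *\<^sub>R Q x + 2 *\<^sub>R Q y)"

text \<open>The minimum written $N''_2(x,a)$, for the fuzzy norm \<open>N'\<close> on the target of the control function \<open>\<phi>\<close>.\<close>
definition N2_bound ::
  "('z::real_vector \<Rightarrow> real \<Rightarrow> real) \<Rightarrow> ('x::real_vector \<Rightarrow> 'x \<Rightarrow> 'z) \<Rightarrow> 'x \<Rightarrow> real \<Rightarrow> real" where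
  "N2_bound N' \<phi> x a =
     Min {N' (\<phi> (x /\<^sub>R 3) (x /\<^sub>R 3)) a,
          N' (\<phi> (x /\<^sub>R 3) x) a,
          N' (\<phi> (x /\<^sub>R 3) ((4/3) *\<^sub>R x)) a,
          N' (\<phi> (x /\<^sub>R 3) ((-2/3) *\<^sub>R x)) a,
          N' (\<phi> (x /\<^sub>R 3) 0) a}"

end

theory Submission
  imports Defs
begin

text \<open>
  Write \<open>D x y\<close> for the vector whose fuzzy size is controlled by \<open>\<phi>\<^sub>2 x y\<close>. With \<open>x = 3 t\<close>, evenness
  of \<open>f\<close> gives \<open>f (2x) - 4 f x = D t (3t) + D t (4t) + D t (-2t) - 2 D t t\<close>, an error of total
  weight 5. Hence \<open>4\<^sup>n f (x / 2\<^sup>n)\<close> is a Cauchy sequence with geometrically decaying steps, and its limit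
  \<open>Q x\<close> is within \<open>5 a / (\<alpha> - 4)\<close> of \<open>f x\<close>; the slack between 5 and 6 absorbs the passage to the limit.
  The limit satisfies \<open>D = 0\<close> and \<open>Q (2x) = 4 Q x\<close>, and comparing the equation at \<open>(x, 2y)\<close> and
  \<open>(y, x)\<close> shows that it is quadratic. Conversely, any quadratic \<open>P\<close> near \<open>f\<close> satisfies
  \<open>P x = 4\<^sup>n P (x / 2\<^sup>n)\<close>, so its distance to \<open>4\<^sup>n f (x / 2\<^sup>n)\<close> tends to 0 and \<open>P = Q\<close>.
\<close>

section \<open>Estimates, limits and completeness in a fuzzy norm\<close>

definition fuzzy_lim :: "('v::real_vector \<Rightarrow> real \<Rightarrow> real) \<Rightarrow> (nat \<Rightarrow> 'v) \<Rightarrow> 'v \<Rightarrow> bool" where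
  "fuzzy_lim N s x \<longleftrightarrow> (\<forall>a>0. (\<lambda>n. N (s n - x) a) \<longlonglongrightarrow> 1)"

context fuzzy_normed_space
begin

lemma le_one: "N x a \<le> 1"
  using range[of x a] by simp

lemma zero_vec: "a > 0 \<Longrightarrow> N 0 a = 1"
  using N2[of 0] by simp

lemma mono_radius: "a \<le> b \<Longrightarrow> N x a \<le> N x b"
  using N5_mono by (simp add: monoD)

lemma minus_commute: "N (x - y) a = N (y - x) a"
  using N3[of "-1" "y - x" a] by simp

lemma scale_pos: "c > 0 \<Longrightarrow> N (c *\<^sub>R x) (c * a) = N x a"
  using N3[of c x "c * a"] by simp

text \<open>Iterated N4: a common lower bound survives addition while the radii add up. The empty
  sum is excluded because \<open>N 0 0 = 0\<close> by N1.\<close>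

lemma sum_ge:
  assumes "finite A" "A \<noteq> {}" "\<And>i. i \<in> A \<Longrightarrow> N (g i) (b i) \<ge> m"
  shows "N (\<Sum>i\<in>A. g i) (\<Sum>i\<in>A. b i) \<ge> m"
  using assms
proof (induction rule: finite_ne_induct)
  case (singleton x)
  then show ?case by simp
next
  case (insert x F)
  have "m \<le> min (N (g x) (b x)) (N (sum g F) (sum b F))"
    using insert by simp
  also have "\<dots> \<le> N (g x + sum g F) (b x + sum b F)"
    by (rule N4)
  finally show ?case using insert by simp
qed

lemma add_ge: "m \<le> N x a \<Longrightarrow> m \<le> N y b \<Longrightarrow> m \<le> N (x + y) (a + b)"
  using N4[where x=x and y=y and a=a and b=b] by linarith

lemma diff_ge: "m \<le> N x a \<Longrightarrow> m \<le> N y b \<Longrightarrow> m \<le> N (x - y) (a + b)"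
  using add_ge[of m x a "- y" b] minus_commute[of 0 y b] by simp

lemma tendsto_one_dominated:
  assumes "h \<longlonglongrightarrow> 1" "\<And>n. h n \<le> N (s n) a"
  shows "(\<lambda>n. N (s n) a) \<longlonglongrightarrow> 1"
  using assms le_one by (intro tendsto_sandwich[OF _ _ assms(1) tendsto_const]) auto

lemma fuzzy_lim_add:
  assumes "fuzzy_lim N s x" "fuzzy_lim N t y"
  shows "fuzzy_lim N (\<lambda>n. s n + t n) (x + y)"
  unfolding fuzzy_lim_def
proof (intro allI impI)
  fix a :: real assume "a > 0"
  then have "(\<lambda>n. min (N (s n - x) (a/2)) (N (t n - y) (a/2))) \<longlonglongrightarrow> min 1 1"
    using assms unfolding fuzzy_lim_def by (intro tendsto_min) auto
  then have "(\<lambda>n. min (N (s n - x) (a/2)) (N (t n - y) (a/2))) \<longlonglongrightarrow> 1"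
    by simp
  then show "(\<lambda>n. N (s n + t n - (x + y)) a) \<longlonglongrightarrow> 1"
  proof (rule tendsto_one_dominated)
    show "min (N (s n - x) (a/2)) (N (t n - y) (a/2)) \<le> N (s n + t n - (x + y)) a" for n
      using N4[of "s n - x" "a/2" "t n - y" "a/2"] by (simp add: algebra_simps)
  qed
qed

lemma fuzzy_lim_scaleR:
  assumes "fuzzy_lim N s x"
  shows "fuzzy_lim N (\<lambda>n. c *\<^sub>R s n) (c *\<^sub>R x)"
proof (cases "c = 0")
  case True
  then show ?thesis by (simp add: fuzzy_lim_def zero_vec)
next
  case False
  then show ?thesis
    using assms by (simp add: fuzzy_lim_def N3 flip: scaleR_diff_right)
qed

lemma fuzzy_lim_diff:
  assumes "fuzzy_lim N s x" "fuzzy_lim N t y"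
  shows "fuzzy_lim N (\<lambda>n. s n - t n) (x - y)"
  using fuzzy_lim_add[OF assms(1) fuzzy_lim_scaleR[OF assms(2), of "-1"]] by simp

lemma fuzzy_lim_const_iff: "fuzzy_lim N (\<lambda>n. x) y \<longleftrightarrow> x = y"
proof -
  have "fuzzy_lim N (\<lambda>n. x) y \<longleftrightarrow> (\<forall>a>0. N (x - y) a = 1)"
    unfolding fuzzy_lim_def by (simp add: LIMSEQ_const_iff)
  also have "\<dots> \<longleftrightarrow> x = y"
    using N2[of "x - y"] by simp
  finally show ?thesis .
qed

text \<open>Subtracting \<open>s\<close> from itself gives the constant sequence 0 with limit
  \<open>x - y\<close>, and N2 separates points.\<close>

lemma fuzzy_lim_unique:
  assumes "fuzzy_lim N s x" "fuzzy_lim N s y"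
  shows "x = y"
  using fuzzy_lim_diff[OF assms] fuzzy_lim_const_iff[of 0 "x - y"] by simp

end

text \<open>The level \<open>m a\<close> is kept along a telescoping sum while the radii form a
  geometric series. The bound on \<open>L\<close> needs a strictly larger radius \<open>b\<close>,
  since passing to the limit costs some positive radius.\<close>

lemma (in fuzzy_Banach_space) geometric_steps_converge:
  fixes c q :: real
  assumes c: "c > 0" and q: "0 < q" "q < 1"
    and m: "(m \<longlongrightarrow> 1) at_top"
    and step: "\<And>n a. a > 0 \<Longrightarrow> m a \<le> N (s (Suc n) - s n) (c * q ^ n * a)"
  shows "\<exists>L. fuzzy_lim N s L \<and> (\<forall>a>0. \<forall>b. b > c / (1 - q) * a \<longrightarrow> m a \<le> N (L - s 0) b)"
proof -
  have tail: "m a \<le> N (s (n + p) - s n) (c / (1 - q) * a * q ^ n)" if "a > 0" "p > 0" for n p a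
  proof -
    have "m a \<le> N (\<Sum>i<p. s (Suc (n + i)) - s (n + i)) (\<Sum>i<p. c * q ^ (n + i) * a)"
      using that by (intro sum_ge step) auto
    moreover have "(\<Sum>i<p. s (Suc (n + i)) - s (n + i)) = s (n + p) - s n"
      using sum_lessThan_telescope[of "\<lambda>i. s (n + i)" p] by simp
    moreover have "(\<Sum>i<p. c * q ^ (n + i) * a) = c * a * q ^ n * (\<Sum>i<p. q ^ i)"
      by (simp add: power_add sum_distrib_left mult_ac)
    moreover have "c * a * q ^ n * (\<Sum>i<p. q ^ i) \<le> c * a * q ^ n * (1 / (1 - q))"
      using c q that by (intro mult_left_mono) (auto simp: sum_gp_strict divide_simps)
    ultimately show ?thesis
      using mono_radius[of "c * a * q ^ n * (\<Sum>i<p. q ^ i)" "c / (1 - q) * a * q ^ n" "s (n + p) - s n"]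
      by (simp add: mult_ac)
  qed
  have "fuzzy_Cauchy N s"
    unfolding fuzzy_Cauchy_def
  proof (intro allI impI)
    fix e b :: real assume e: "e > 0" and b: "b > 0"
    \<comment> \<open>First \<open>a\<close> is taken so large that the level exceeds
      \<open>1 - e\<close>; only then is \<open>n\<close> increased until the tail radius for this
      fixed \<open>a\<close> drops below \<open>b\<close>.\<close>
    have "\<forall>\<^sub>F a in at_top. m a > 1 - e"
      using m e by (intro order_tendstoD(1)) auto
    then have "\<forall>\<^sub>F a in at_top. m a > 1 - e \<and> a > 0"
      using eventually_gt_at_top[of 0] by (rule eventually_conj)
    then obtain a where a: "m a > 1 - e" "a > 0"
      using eventually_happens'[OF trivial_limit_at_top_linorder] by blast
    have "(\<lambda>n. c / (1 - q) * a * q ^ n) \<longlonglongrightarrow> c / (1 - q) * a * 0"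
      using q by (intro tendsto_mult tendsto_const LIMSEQ_power_zero) auto
    then have "\<forall>\<^sub>F n in sequentially. c / (1 - q) * a * q ^ n < b"
      using b by (intro order_tendstoD(2)) auto
    then obtain n0 where n0: "\<And>n. n \<ge> n0 \<Longrightarrow> c / (1 - q) * a * q ^ n < b"
      unfolding eventually_sequentially by blast
    have "N (s (n + p) - s n) b > 1 - e" if "n \<ge> n0" "p > 0" for n p
      using tail[of a p n] mono_radius[OF less_imp_le[OF n0[OF that(1)]], of "s (n + p) - s n"] a that
      by linarith
    then show "\<exists>n0. \<forall>n\<ge>n0. \<forall>p>0. N (s (n + p) - s n) b > 1 - e" by blast
  qed
  then obtain L where L: "fuzzy_lim N s L"
    using complete unfolding fuzzy_convergent_def fuzzy_lim_def by blast
  have "m a \<le> N (L - s 0) b" if a: "a > 0" and b: "b > c / (1 - q) * a" for a b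
  proof -
    \<comment> \<open>The surplus radius \<open>d\<close> pays for the distance from
      \<open>s n\<close> to \<open>L\<close>, the rest for the tail from \<open>s 0\<close> to
      \<open>s n\<close>.\<close>
    define d where "d = b - c / (1 - q) * a"
    have "d > 0" using b by (simp add: d_def)
    then have "(\<lambda>n. N (s n - L) d) \<longlonglongrightarrow> 1"
      using L by (simp add: fuzzy_lim_def)
    then have lim: "(\<lambda>n. min (N (s n - L) d) (m a)) \<longlonglongrightarrow> min 1 (m a)"
      by (intro tendsto_min tendsto_const)
    have "min (N (s n - L) d) (m a) \<le> N (L - s 0) b" if "n > 0" for n
      using N4[of "L - s n" d "s n - s 0" "c / (1 - q) * a"] tail[OF a that, of 0]
      by (simp add: d_def minus_commute[of L "s n"])
    then have "min 1 (m a) \<le> N (L - s 0) b"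
      by (intro tendsto_upperbound[OF lim] eventually_sequentiallyI[of 1]) auto
    moreover have "m a \<le> 1"
      using step[OF a, of 0] le_one order_trans by blast
    ultimately show ?thesis by simp
  qed
  then show ?thesis using L by blast
qed

section \<open>Quadratic mappings and doubling\<close>

lemma quadratic_mappingI:
  fixes Q :: "'x::real_vector \<Rightarrow> 'y::real_vector"
  assumes even: "\<And>x. Q (- x) = Q x"
    and double: "\<And>x. Q (2 *\<^sub>R x) = 4 *\<^sub>R Q x"
    and eq: "\<And>x y. Q (2 *\<^sub>R x + y) + Q (2 *\<^sub>R x - y) - Q (x + y) - Q (x - y)
                - 2 *\<^sub>R Q (2 *\<^sub>R x) + 2 *\<^sub>R Q x = 0"
  shows "quadratic_mapping Q"
  unfolding quadratic_mapping_def
proof (intro allI)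
  fix x y
  have E: "Q (2 *\<^sub>R x + y) + Q (2 *\<^sub>R x - y) = Q (x + y) + Q (x - y) + 6 *\<^sub>R Q x" for x y
    using eq[of x y] scaleR_add_left[of 2 6 "Q x"] by (simp add: double algebra_simps)
  \<comment> \<open>In \<open>E\<close> at \<open>(x, 2y)\<close> the left side has arguments
    \<open>2 (x + y)\<close> and \<open>2 (x - y)\<close>, so doubling extracts the factor
    4.\<close>
  have "4 *\<^sub>R (Q (x + y) + Q (x - y)) = Q (x + 2 *\<^sub>R y) + Q (x - 2 *\<^sub>R y) + 6 *\<^sub>R Q x"
    using E[of x "2 *\<^sub>R y"] double[of "x + y"] double[of "x - y"] by (simp add: algebra_simps)
  \<comment> \<open>\<open>E\<close> with the roles of \<open>x\<close> and \<open>y\<close>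
    exchanged, up to evenness; this eliminates the values at \<open>x + 2y\<close> and
    \<open>x - 2y\<close>.\<close>
  also have "Q (x + 2 *\<^sub>R y) + Q (x - 2 *\<^sub>R y) = Q (x + y) + Q (x - y) + 6 *\<^sub>R Q y"
    using E[of y x] even[of "x - y"] even[of "x - 2 *\<^sub>R y"] by (simp add: add.commute)
  finally have "3 *\<^sub>R (Q (x + y) + Q (x - y)) = 3 *\<^sub>R (2 *\<^sub>R Q x + 2 *\<^sub>R Q y)"
    using scaleR_add_left[of 1 3 "Q (x + y)"] scaleR_add_left[of 1 3 "Q (x - y)"]
    by (simp add: algebra_simps)
  then show "Q (x + y) + Q (x - y) = 2 *\<^sub>R Q x + 2 *\<^sub>R Q y"
    by simp
qed

text \<open>The equation at \<open>(0, 0)\<close> forces \<open>Q 0 = 0\<close>; then take equal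
  arguments.\<close>

lemma quadratic_mapping_double:
  assumes "quadratic_mapping Q"
  shows "Q (2 *\<^sub>R x) = 4 *\<^sub>R Q x"
proof -
  have "Q 0 + Q 0 = 2 *\<^sub>R Q 0 + 2 *\<^sub>R Q 0"
    using assms unfolding quadratic_mapping_def by (metis add.right_neutral diff_zero)
  then have "Q 0 = 0" by (simp flip: scaleR_2)
  moreover have "Q (x + x) + Q (x - x) = 2 *\<^sub>R Q x + 2 *\<^sub>R Q x"
    using assms unfolding quadratic_mapping_def by blast
  ultimately have "Q (x + x) = (2 + 2) *\<^sub>R Q x" by (simp only: scaleR_add_left) simp
  then show ?thesis by (simp add: scaleR_2)
qed

lemma quadratic_mapping_halvings:
  assumes "quadratic_mapping Q"
  shows "4 ^ n *\<^sub>R Q (x /\<^sub>R 2 ^ n) = Q x"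
proof (induction n)
  case (Suc n)
  have "Q (x /\<^sub>R 2 ^ n) = 4 *\<^sub>R Q (x /\<^sub>R 2 ^ Suc n)"
    using quadratic_mapping_double[OF assms, of "x /\<^sub>R 2 ^ Suc n"] by simp
  then show ?case using Suc by (simp add: mult.commute)
qed simp

section \<open>The control bound as a level function\<close>

lemma N2_bound_ge_iff:
  "m \<le> N2_bound N' \<phi> x a \<longleftrightarrow>
     m \<le> N' (\<phi> (x /\<^sub>R 3) (x /\<^sub>R 3)) a \<and> m \<le> N' (\<phi> (x /\<^sub>R 3) x) a \<and>
     m \<le> N' (\<phi> (x /\<^sub>R 3) ((4/3) *\<^sub>R x)) a \<and> m \<le> N' (\<phi> (x /\<^sub>R 3) ((-2/3) *\<^sub>R x)) a \<and>
     m \<le> N' (\<phi> (x /\<^sub>R 3) 0) a"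
  by (simp add: N2_bound_def)

text \<open>By N5 in each entry. This makes the bound admissible as \<open>m\<close> in
  \<open>geometric_steps_converge\<close> and also drives uniqueness.\<close>

lemma (in fuzzy_normed_space) N2_bound_tendsto_one: "(N2_bound N \<phi> x \<longlongrightarrow> 1) at_top"
proof -
  have "N2_bound N \<phi> x = (\<lambda>a.
      min (N (\<phi> (x /\<^sub>R 3) (x /\<^sub>R 3)) a) (min (N (\<phi> (x /\<^sub>R 3) x) a)
      (min (N (\<phi> (x /\<^sub>R 3) ((4/3) *\<^sub>R x)) a) (min (N (\<phi> (x /\<^sub>R 3) ((-2/3) *\<^sub>R x)) a)
      (N (\<phi> (x /\<^sub>R 3) 0) a)))))"
    by (simp add: N2_bound_def fun_eq_iff)
  moreover have "(\<dots> \<longlongrightarrow> min 1 (min 1 (min 1 (min 1 1)))) at_top"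
    by (intro tendsto_min N5_lim)
  ultimately show ?thesis by simp
qed

section \<open>Existence and uniqueness of the approximating quadratic mapping\<close>

theorem theorem2p2:
  fixes N :: "'y::real_vector \<Rightarrow> real \<Rightarrow> real"
    and N' :: "'z::real_vector \<Rightarrow> real \<Rightarrow> real"
    and \<phi>\<^sub>2 :: "'x::real_vector \<Rightarrow> 'x \<Rightarrow> 'z"
    and f :: "'x \<Rightarrow> 'y"
    and \<alpha> :: real
  assumes "fuzzy_Banach_space N"
    and "fuzzy_normed_space N'"
    and "\<alpha> > 4"
    and "\<And>x y a. y \<in> {0, x /\<^sub>R 3, (4/3) *\<^sub>R x, (-2/3) *\<^sub>R x, x} \<Longrightarrow> a > 0 \<Longrightarrow>
           N' (\<phi>\<^sub>2 (x /\<^sub>R (2 * 3)) (y /\<^sub>R 2)) a \<ge> N' (\<phi>\<^sub>2 (x /\<^sub>R 3) y) (\<alpha> * a)"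
    and "\<And>x y a. a > 0 \<Longrightarrow>
           (\<lambda>n::nat. N' (4 ^ n *\<^sub>R \<phi>\<^sub>2 (x /\<^sub>R 2 ^ n) (y /\<^sub>R 2 ^ n)) a) \<longlonglongrightarrow> 1"
    and "\<And>x. f (- x) = f x"
    and "f 0 = 0"
    and "\<And>x y a. a > 0 \<Longrightarrow>
           N (f (2 *\<^sub>R x + y) + f (2 *\<^sub>R x - y) - f (x + y) - f (x - y)
                - 2 *\<^sub>R f (2 *\<^sub>R x) + 2 *\<^sub>R f x) a \<ge> N' (\<phi>\<^sub>2 x y) a"
  shows "\<exists>!Q :: 'x \<Rightarrow> 'y. quadratic_mapping Q \<and>
           (\<forall>x. \<forall>a>0. N (Q x - f x) a \<ge> N2_bound N' \<phi>\<^sub>2 x (a * (\<alpha> - 4) / 6))"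
proof -
  interpret Y: fuzzy_Banach_space N by fact
  interpret Z: fuzzy_normed_space N' by fact
  note \<alpha> = assms(3) and phi_half = assms(4) and phi_lim = assms(5)
    and f_even = assms(6) and f0 = assms(7) and f_approx = assms(8)
  let ?B = "N2_bound N' \<phi>\<^sub>2"
  define D where "D g x y = g (2 *\<^sub>R x + y) + g (2 *\<^sub>R x - y) - g (x + y) - g (x - y)
      - 2 *\<^sub>R g (2 *\<^sub>R x) + 2 *\<^sub>R g x" for g :: "'x \<Rightarrow> 'y" and x y

  \<comment> \<open>Every second argument in the bound is a fixed multiple of \<open>x\<close>, so
    halving \<open>x\<close> halves both arguments and the hypothesis applies entry by
    entry.\<close>
  have half: "?B x (\<alpha> * a) \<le> ?B (x /\<^sub>R 2) a" if "a > 0" for x a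
  proof -
    have "N' (\<phi>\<^sub>2 (x /\<^sub>R 3) y) (\<alpha> * a) \<le> N' (\<phi>\<^sub>2 (x /\<^sub>R 2 /\<^sub>R 3) (y /\<^sub>R 2)) a"
      if "y \<in> {0, x /\<^sub>R 3, (4/3) *\<^sub>R x, (-2/3) *\<^sub>R x, x}" for y
      using phi_half[OF that \<open>a > 0\<close>] by simp
    from this[of 0] this[of "x /\<^sub>R 3"] this[of "(4/3) *\<^sub>R x"] this[of "(-2/3) *\<^sub>R x"] this[of x]
      N2_bound_ge_iff[of "?B x (\<alpha> * a)" N' \<phi>\<^sub>2 x "\<alpha> * a"]
    show ?thesis
      unfolding N2_bound_ge_iff[of _ N' \<phi>\<^sub>2 "x /\<^sub>R 2"] by (auto intro: order_trans simp: mult_ac)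
  qed
  have halves: "?B x (\<alpha> ^ n * a) \<le> ?B (x /\<^sub>R 2 ^ n) a" if "a > 0" for x n a
    using that
  proof (induction n arbitrary: a)
    case (Suc n)
    have "?B x (\<alpha> ^ Suc n * a) \<le> ?B (x /\<^sub>R 2 ^ n) (\<alpha> * a)"
      using Suc.IH[of "\<alpha> * a"] Suc.prems \<alpha> by (simp add: mult_ac)
    also have "\<dots> \<le> ?B (x /\<^sub>R 2 ^ Suc n) a"
      using half[OF Suc.prems, of "x /\<^sub>R 2 ^ n"] by (simp add: mult_ac)
    finally show ?case .
  qed simp

  have double: "?B x a \<le> N (4 *\<^sub>R f x - f (2 *\<^sub>R x)) (5 * a)" if "a > 0" for x a
  proof -
    define t where "t = x /\<^sub>R 3"
    have x: "x = 3 *\<^sub>R t" by (simp add: t_def)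
    have B: "?B x a \<le> N (D f t y) a" if "y \<in> {t, 3 *\<^sub>R t, 4 *\<^sub>R t, (-2) *\<^sub>R t}" for y
      using that N2_bound_ge_iff[of "?B x a" N' \<phi>\<^sub>2 x a] f_approx[OF \<open>a > 0\<close>, of t y]
      unfolding D_def by (auto simp: x intro: order_trans)
    have "?B x a \<le> N (2 *\<^sub>R D f t t) (2 * a)"
      using B[of t] Y.scale_pos[of 2 "D f t t" a] by simp
    \<comment> \<open>Radius 5: the doubled term contributes \<open>2 * a\<close>, the other three
      contribute \<open>a\<close> each.\<close>
    then have "?B x a \<le> N (2 *\<^sub>R D f t t - (D f t (3 *\<^sub>R t) + D f t (4 *\<^sub>R t) + D f t ((-2) *\<^sub>R t)))
        (2 * a + (a + a + a))"
      by (intro Y.diff_ge Y.add_ge B) auto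
    \<comment> \<open>In the sum of three the values at \<open>4t\<close> and \<open>5t\<close>
      cancel; subtracting it from twice \<open>D f t t\<close> removes those at \<open>t\<close> and
      \<open>2t\<close>, leaving only \<open>3t = x\<close> and \<open>6t = 2x\<close>.\<close>
    moreover have "2 *\<^sub>R D f t t - (D f t (3 *\<^sub>R t) + D f t (4 *\<^sub>R t) + D f t ((-2) *\<^sub>R t))
        = 4 *\<^sub>R f x - f (2 *\<^sub>R x)"
    proof -
      have collect: "t + c *\<^sub>R t = (1 + c) *\<^sub>R t" "c *\<^sub>R t + t = (c + 1) *\<^sub>R t"
        "t - c *\<^sub>R t = (1 - c) *\<^sub>R t" "c *\<^sub>R t - t = (c - 1) *\<^sub>R t" "t + t = 2 *\<^sub>R t" for c
        by (simp_all add: scaleR_left_distrib scaleR_left_diff_distrib scaleR_2)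
      have args: "2 *\<^sub>R t + t = 3 *\<^sub>R t" "2 *\<^sub>R t - t = t" "t + t = 2 *\<^sub>R t"
        "2 *\<^sub>R t + 3 *\<^sub>R t = 5 *\<^sub>R t" "2 *\<^sub>R t - 3 *\<^sub>R t = - t" "t + 3 *\<^sub>R t = 4 *\<^sub>R t"
        "t - 3 *\<^sub>R t = - (2 *\<^sub>R t)"
        "2 *\<^sub>R t + 4 *\<^sub>R t = 6 *\<^sub>R t" "2 *\<^sub>R t - 4 *\<^sub>R t = - (2 *\<^sub>R t)" "t + 4 *\<^sub>R t = 5 *\<^sub>R t"
        "t - 4 *\<^sub>R t = - (3 *\<^sub>R t)"
        "2 *\<^sub>R t + (-2) *\<^sub>R t = 0" "2 *\<^sub>R t - (-2) *\<^sub>R t = 4 *\<^sub>R t" "t + (-2) *\<^sub>R t = - t"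
        "t - (-2) *\<^sub>R t = 3 *\<^sub>R t"
        by (simp_all add: collect flip: scaleR_add_left scaleR_diff_left scaleR_minus_left)
      have "2 *\<^sub>R x = 6 *\<^sub>R t" by (simp add: x)
      then show ?thesis
        unfolding D_def args f_even x
        using scaleR_add_left[of 2 2 "f t"] scaleR_add_left[of 2 2 "f (2 *\<^sub>R t)"]
          scaleR_add_left[of 2 2 "f (3 *\<^sub>R t)"] scaleR_2[of "f (3 *\<^sub>R t)"]
        by (simp add: f0 algebra_simps)
    qed
    moreover have "2 * a + (a + a + a) = 5 * a" by simp
    ultimately show ?thesis by (simp only:)
  qed

  define s where "s x n = 4 ^ n *\<^sub>R f (x /\<^sub>R 2 ^ n)" for x n
  have step: "?B x a \<le> N (s x (Suc n) - s x n) (5 / \<alpha> * (4 / \<alpha>) ^ n * a)" if "a > 0" for x n a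
  proof -
    \<comment> \<open>Chosen so that \<open>n + 1\<close> halvings, each costing a factor \<alpha>,
      start from level \<open>a\<close>: the doubling estimate is applied at
      \<open>x / 2^(n+1)\<close>. Scaling by \<open>4^n\<close> then gives ratio 4/\<alpha> <
      1.\<close>
    define b where "b = a / \<alpha> ^ Suc n"
    have b: "b > 0" using that \<alpha> by (simp add: b_def)
    have "?B x a = ?B x (\<alpha> ^ Suc n * b)" using \<alpha> by (simp add: b_def)
    also have "\<dots> \<le> ?B (x /\<^sub>R 2 ^ Suc n) b" by (rule halves[OF b])
    also have "\<dots> \<le> N (4 *\<^sub>R f (x /\<^sub>R 2 ^ Suc n) - f (x /\<^sub>R 2 ^ n)) (5 * b)"
      using double[OF b, of "x /\<^sub>R 2 ^ Suc n"] by simp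
    also have "\<dots> = N (s x (Suc n) - s x n) (4 ^ n * (5 * b))"
      using Y.scale_pos[of "4 ^ n" "4 *\<^sub>R f (x /\<^sub>R 2 ^ Suc n) - f (x /\<^sub>R 2 ^ n)" "5 * b"]
      by (simp add: s_def scaleR_diff_right mult.commute)
    also have "4 ^ n * (5 * b) = 5 / \<alpha> * (4 / \<alpha>) ^ n * a"
      by (simp add: b_def power_divide)
    finally show ?thesis .
  qed
  have "\<exists>L. fuzzy_lim N (s x) L \<and>
      (\<forall>a>0. \<forall>b. b > 5 / \<alpha> / (1 - 4 / \<alpha>) * a \<longrightarrow> ?B x a \<le> N (L - s x 0) b)" for x
    using \<alpha> by (intro Y.geometric_steps_converge step Z.N2_bound_tendsto_one) auto
  then obtain Q where Q_lim: "\<And>x. fuzzy_lim N (s x) (Q x)"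
    and Q_near: "\<And>x a b. a > 0 \<Longrightarrow> b > 5 / \<alpha> / (1 - 4 / \<alpha>) * a \<Longrightarrow> ?B x a \<le> N (Q x - s x 0) b"
    by metis
  have const: "5 / \<alpha> / (1 - 4 / \<alpha>) = 5 / (\<alpha> - 4)"
    using \<alpha> by (simp add: field_simps)
  have Q_bound: "?B x (a * (\<alpha> - 4) / 6) \<le> N (Q x - f x) a" if "a > 0" for x a
  proof -
    \<comment> \<open>The left side equals \<open>5 * a / 6\<close>, which supplies the strict
      inequality required by \<open>Q_near\<close>.\<close>
    have "5 / (\<alpha> - 4) * (a * (\<alpha> - 4) / 6) < a" using \<alpha> that by simp
    then show ?thesis
      using Q_near[unfolded const, of "a * (\<alpha> - 4) / 6" a x] \<alpha> that by (simp add: s_def)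
  qed
  have Q_quad: "quadratic_mapping Q"
  proof (rule quadratic_mappingI)
    show "Q (- x) = Q x" for x
    proof (rule Y.fuzzy_lim_unique[OF Q_lim])
      have "s (- x) = s x" by (simp add: s_def f_even fun_eq_iff)
      then show "fuzzy_lim N (s (- x)) (Q x)" using Q_lim[of x] by simp
    qed
    show "Q (2 *\<^sub>R x) = 4 *\<^sub>R Q x" for x
    proof (rule Y.fuzzy_lim_unique)
      \<comment> \<open>Halving \<open>2x\<close> once more than \<open>x\<close> reaches the same
        point, so shifting the index by one leaves exactly a factor 4.\<close>
      have "(\<lambda>n. s (2 *\<^sub>R x) (Suc n)) = (\<lambda>n. 4 *\<^sub>R s x n)"
        by (simp add: s_def)
      moreover have "fuzzy_lim N (\<lambda>n. s (2 *\<^sub>R x) (Suc n)) (Q (2 *\<^sub>R x))"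
        using Q_lim[of "2 *\<^sub>R x"] unfolding fuzzy_lim_def by (auto intro: LIMSEQ_Suc)
      ultimately show "fuzzy_lim N (\<lambda>n. 4 *\<^sub>R s x n) (Q (2 *\<^sub>R x))" by simp
    qed (intro Y.fuzzy_lim_scaleR Q_lim)
    fix x y
    \<comment> \<open>One sequence with two limits: \<open>D Q x y\<close> by the limit laws, and 0
      because it equals \<open>4^n\<close> times \<open>D f\<close> at the halved arguments, which
      the hypothesis on \<phi> controls.\<close>
    have "D Q x y = 0"
    proof (rule Y.fuzzy_lim_unique)
      show "fuzzy_lim N (\<lambda>n. D (\<lambda>z. s z n) x y) (D Q x y)"
        unfolding D_def by (intro Y.fuzzy_lim_add Y.fuzzy_lim_diff Y.fuzzy_lim_scaleR Q_lim)
      show "fuzzy_lim N (\<lambda>n. D (\<lambda>z. s z n) x y) 0"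
        unfolding fuzzy_lim_def diff_zero
      proof (intro allI impI Y.tendsto_one_dominated[OF phi_lim])
        fix a :: real and n :: nat assume a: "a > 0"
        then have a': "a / 4 ^ n > 0" by simp
        have "N' (4 ^ n *\<^sub>R \<phi>\<^sub>2 (x /\<^sub>R 2 ^ n) (y /\<^sub>R 2 ^ n)) a
            = N' (\<phi>\<^sub>2 (x /\<^sub>R 2 ^ n) (y /\<^sub>R 2 ^ n)) (a / 4 ^ n)"
          by (simp add: Z.N3)
        also have "\<dots> \<le> N (D f (x /\<^sub>R 2 ^ n) (y /\<^sub>R 2 ^ n)) (a / 4 ^ n)"
          unfolding D_def by (rule f_approx[OF a'])
        also have "\<dots> = N (4 ^ n *\<^sub>R D f (x /\<^sub>R 2 ^ n) (y /\<^sub>R 2 ^ n)) a"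
          by (simp add: Y.N3)
        also have "4 ^ n *\<^sub>R D f (x /\<^sub>R 2 ^ n) (y /\<^sub>R 2 ^ n) = D (\<lambda>z. s z n) x y"
          by (simp add: D_def s_def scaleR_add_right scaleR_diff_right mult_ac)
        finally show "N' (4 ^ n *\<^sub>R \<phi>\<^sub>2 (x /\<^sub>R 2 ^ n) (y /\<^sub>R 2 ^ n)) a \<le> N (D (\<lambda>z. s z n) x y) a" .
      qed
    qed
    then show "Q (2 *\<^sub>R x + y) + Q (2 *\<^sub>R x - y) - Q (x + y) - Q (x - y)
        - 2 *\<^sub>R Q (2 *\<^sub>R x) + 2 *\<^sub>R Q x = 0"
      by (simp add: D_def)
  qed

  show ?thesis
  proof (intro ex1I[of _ Q] conjI allI impI Q_quad Q_bound)
    fix P assume P: "quadratic_mapping P \<and>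
      (\<forall>x. \<forall>a>0. N (P x - f x) a \<ge> ?B x (a * (\<alpha> - 4) / 6))"
    have P_lim: "fuzzy_lim N (s x) (P x)" for x
      unfolding fuzzy_lim_def
    proof (intro allI impI Y.tendsto_one_dominated)
      fix a :: real assume a: "a > 0"
      \<comment> \<open>Closeness of \<open>P\<close> and \<open>f\<close> at \<open>x / 2^n\<close>
        with radius \<open>a / 4^n\<close>, carried back to \<open>x\<close> by
        \<open>halves\<close>, yields the argument with factor \<open>(\<alpha> / 4)^n\<close>. It
        diverges since \<alpha> > 4, so the bound tends to 1.\<close>
      have "filterlim (\<lambda>n. a * (\<alpha> - 4) / 6 * (\<alpha> / 4) ^ n) at_top sequentially"
        using \<alpha> a by (intro filterlim_tendsto_pos_mult_at_top[OF tendsto_const]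
            filterlim_at_infinity_imp_filterlim_at_top filterlim_realpow_sequentially_gt1) auto
      then show "(\<lambda>n. ?B x (a * (\<alpha> - 4) / 6 * (\<alpha> / 4) ^ n)) \<longlonglongrightarrow> 1"
        by (rule filterlim_compose[OF Z.N2_bound_tendsto_one])
      fix n
      have pos: "a / 4 ^ n > 0" "a / 4 ^ n * (\<alpha> - 4) / 6 > 0" using a \<alpha> by auto
      have "?B x (a * (\<alpha> - 4) / 6 * (\<alpha> / 4) ^ n) = ?B x (\<alpha> ^ n * (a / 4 ^ n * (\<alpha> - 4) / 6))"
        by (simp add: power_divide mult_ac)
      also have "\<dots> \<le> ?B (x /\<^sub>R 2 ^ n) (a / 4 ^ n * (\<alpha> - 4) / 6)"
        by (rule halves[OF pos(2)])
      also have "\<dots> \<le> N (P (x /\<^sub>R 2 ^ n) - f (x /\<^sub>R 2 ^ n)) (a / 4 ^ n)"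
        using P pos(1) by blast
      also have "\<dots> = N (4 ^ n *\<^sub>R (P (x /\<^sub>R 2 ^ n) - f (x /\<^sub>R 2 ^ n))) a"
        by (simp add: Y.N3)
      also have "\<dots> = N (s x n - P x) a"
        using quadratic_mapping_halvings[OF conjunct1[OF P], of n x] Y.minus_commute[of "P x" "s x n" a]
        by (simp add: scaleR_diff_right s_def)
      finally show "?B x (a * (\<alpha> - 4) / 6 * (\<alpha> / 4) ^ n) \<le> N (s x n - P x) a" .
    qed
    show "P = Q"
      using Y.fuzzy_lim_unique[OF P_lim Q_lim] by blast
  qed
qed

end
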